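(* Let $P(x)=\sum_{\mathbf m}a_{\mathbf m}x^{\mathbf m}$ be a polynomial in $n$ complex variables that has definite parity (i.e. all monomials with nonzero coefficient have total degrees of the same parity; equivalently $P$ is even or odd) and has the half-plane property. Then all the nonzero coefficients $a_{\mathbf m}$ have the same phase, i.e. $a_{\mathbf m}/a_{\mathbf m'}\in(0,\infty)$ whenever $a_{\mathbf m},a_{\mathbf m'}\neq 0$.
   Context: A polynomial $P$ in $n$ complex variables has the half-plane property if it is either identically zero or else $P(x)\neq 0$ whenever $\operatorname{Re}x_i>0$ for all $i$. *)

theory Defs
  imports Complex_Main "HOL-Library.Poly_Mapping"
begin

text \<open>Multivariate polynomials with complex coefficients are finitely supported maps from monomials
  to coefficients; a monomial is a finitely supported map from variable indices to exponents.
  The variables of a polynomial in \<open>n\<close> variables are indexed by \<open>0, \<dots>, n - 1\<close>.\<close>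

type_synonym monomial = "nat \<Rightarrow>\<^sub>0 nat"
type_synonym cpoly = "monomial \<Rightarrow>\<^sub>0 complex"

definition in_variables :: "nat \<Rightarrow> cpoly \<Rightarrow> bool" where
  "in_variables n P \<longleftrightarrow> (\<forall>m \<in> Poly_Mapping.keys P. Poly_Mapping.keys m \<subseteq> {..<n})"

definition eval_monomial :: "monomial \<Rightarrow> (nat \<Rightarrow> complex) \<Rightarrow> complex" where
  "eval_monomial m x = (\<Prod>i \<in> Poly_Mapping.keys m. x i ^ Poly_Mapping.lookup m i)"

definition eval_cpoly :: "cpoly \<Rightarrow> (nat \<Rightarrow> complex) \<Rightarrow> complex" where
  "eval_cpoly P x = (\<Sum>m \<in> Poly_Mapping.keys P. Poly_Mapping.lookup P m * eval_monomial m x)"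

definition total_degree :: "monomial \<Rightarrow> nat" where
  "total_degree m = (\<Sum>i \<in> Poly_Mapping.keys m. Poly_Mapping.lookup m i)"

definition definite_parity :: "cpoly \<Rightarrow> bool" where
  "definite_parity P \<longleftrightarrow>
     (\<forall>m \<in> Poly_Mapping.keys P. \<forall>m' \<in> Poly_Mapping.keys P.
        even (total_degree m) \<longleftrightarrow> even (total_degree m'))"

definition half_plane_property :: "nat \<Rightarrow> cpoly \<Rightarrow> bool" where
  "half_plane_property n P \<longleftrightarrow>
     P = 0 \<or> (\<forall>x :: nat \<Rightarrow> complex. (\<forall>i<n. Re (x i) > 0) \<longrightarrow> eval_cpoly P x \<noteq> 0)"

end

theory Submission
  imports Defs "HOL-Computational_Algebra.Fundamental_Theorem_Algebra"
begin

text \<open>For real \<open>b\<close> and positive \<open>a\<close>, the polynomial \<open>t \<mapsto> P(at + ib)\<close> has no zeros off the imaginary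
  axis: the half-plane property excludes \<open>Re t > 0\<close>, and parity then excludes \<open>Re t < 0\<close>. Its leading
  coefficient does not depend on \<open>b\<close>, so up to one common constant \<open>P(ib)\<close> is real for all real \<open>b\<close>;
  by parity again, \<open>P\<close> is a constant times a polynomial with real coefficients. After normalisation
  the latter is positive on the positive orthant. Since \<open>Re (\<partial>\<^sub>iP / P) \<ge> 0\<close> on the right half-space,
  every \<open>P + e \<partial>\<^sub>iP\<close> with \<open>e > 0\<close> inherits these properties, and letting \<open>e \<rightarrow> \<infinity>\<close> repeatedly shows
  that all coefficients are nonnegative.\<close>

section \<open>Monomials and evaluation of polynomials\<close>

abbreviation lk :: "('a \<Rightarrow>\<^sub>0 'b::zero) \<Rightarrow> 'a \<Rightarrow> 'b" where "lk \<equiv> Poly_Mapping.lookup"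
abbreviation sg :: "'a \<Rightarrow> 'b::zero \<Rightarrow> 'a \<Rightarrow>\<^sub>0 'b" where "sg \<equiv> Poly_Mapping.single"

text \<open>A nonzero monomial contains some variable, and dividing by it lowers the total degree.
  This is the induction that reduces claims about arbitrary coefficients to constant coefficients,
  by differentiating once per step.\<close>

lemma monomial_induct [case_names zero plus_single]:
  fixes m :: monomial
  assumes "Q 0" and "\<And>m i. Q m \<Longrightarrow> Q (m + sg i 1)"
  shows "Q m"
proof (induction "total_degree m" arbitrary: m rule: less_induct)
  case less
  show ?case
  proof (cases "m = 0")
    case True then show ?thesis using assms(1) by simp
  next
    case False
    then obtain i where i: "i \<in> Poly_Mapping.keys m" by (metis equals0I keys_eq_empty)
    define m' where "m' = m - sg i 1"
    have lk': "lk m' j = (if j = i then lk m i - 1 else lk m j)" for j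
      by (simp add: m'_def lookup_minus lookup_single when_def)
    have pos: "lk m i > 0" using i by (simp add: in_keys_iff)
    have eq: "m = m' + sg i 1"
      using pos by (intro poly_mapping_eqI) (auto simp: lookup_add lk' lookup_single when_def)
    have "total_degree m' = (\<Sum>j\<in>Poly_Mapping.keys m. lk m' j)"
      unfolding total_degree_def
      by (rule sum.mono_neutral_left) (auto simp: in_keys_iff lk' split: if_splits)
    also have "\<dots> < total_degree m" unfolding total_degree_def
      by (rule sum_strict_mono_ex1) (use i pos lk' in auto)
    finally show ?thesis using assms(2) less eq by metis
  qed
qed

lemma eval_monomial_remove:
  "eval_monomial m (x(i := t)) = (\<Prod>j\<in>Poly_Mapping.keys m - {i}. x j ^ lk m j) * t ^ lk m i"
proof (cases "i \<in> Poly_Mapping.keys m")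
  case True
  then show ?thesis unfolding eval_monomial_def
    by (subst prod.remove[OF finite_keys True]) (simp add: mult.commute)
next
  case False
  then show ?thesis unfolding eval_monomial_def
    by (auto simp: in_keys_iff intro!: prod.cong)
qed

text \<open>If the exponent of \<open>i\<close> is 0, both truncated subtractions do nothing, so the
  formula needs no case distinction.\<close>

lemma eval_monomial_minus_single_upd:
  "eval_monomial (m - sg i 1) (x(i := t)) =
     (\<Prod>j\<in>Poly_Mapping.keys m - {i}. x j ^ lk m j) * t ^ (lk m i - 1)"
proof -
  have "Poly_Mapping.keys (m - sg i 1) - {i} = Poly_Mapping.keys m - {i}"
    by (auto simp: in_keys_iff lookup_minus lookup_single when_def)
  then show ?thesis
    unfolding eval_monomial_remove
    by (auto simp: lookup_minus lookup_single when_def intro!: prod.cong)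
qed

lemma eval_monomial_scale:
  "eval_monomial m (\<lambda>i. c * x i) = c ^ total_degree m * eval_monomial m x"
  by (simp add: eval_monomial_def total_degree_def power_mult_distrib prod.distrib power_sum)

lemma eval_cpoly_superset:
  assumes "finite S" "Poly_Mapping.keys P \<subseteq> S"
  shows "eval_cpoly P x = (\<Sum>m\<in>S. lk P m * eval_monomial m x)"
  unfolding eval_cpoly_def
  by (rule sum.mono_neutral_left) (use assms in \<open>auto simp: in_keys_iff\<close>)

lemma eval_cpoly_0: "eval_cpoly 0 x = 0"
  by (simp add: eval_cpoly_def)

lemma eval_cpoly_single: "eval_cpoly (sg m c) x = c * eval_monomial m x"
  by (subst eval_cpoly_superset[of "{m}"]) auto

lemma eval_cpoly_add: "eval_cpoly (P + Q) x = eval_cpoly P x + eval_cpoly Q x"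
proof -
  let ?S = "Poly_Mapping.keys P \<union> Poly_Mapping.keys Q"
  have "Poly_Mapping.keys (P + Q) \<subseteq> ?S" by (rule keys_add)
  then show ?thesis
    by (simp add: eval_cpoly_superset[of ?S] lookup_add algebra_simps sum.distrib)
qed

lemma eval_cpoly_sum: "eval_cpoly (\<Sum>a\<in>A. F a) x = (\<Sum>a\<in>A. eval_cpoly (F a) x)"
  by (induction A rule: infinite_finite_induct) (auto simp: eval_cpoly_0 eval_cpoly_add)

lemma eval_cpoly_sum_single:
  "eval_cpoly (\<Sum>a\<in>A. sg (g a) (f a)) x = (\<Sum>a\<in>A. f a * eval_monomial (g a) x)"
  by (simp add: eval_cpoly_sum eval_cpoly_single)

section \<open>Partial derivatives and one-variable slices\<close>

text \<open>\<open>c\<close> times the \<open>i\<close>-th partial derivative; for exponent 0 the truncated subtraction is harmless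
  because the coefficient vanishes.\<close>
definition mderiv :: "complex \<Rightarrow> nat \<Rightarrow> cpoly \<Rightarrow> cpoly" where
  "mderiv c i P = (\<Sum>m\<in>Poly_Mapping.keys P. sg (m - sg i 1) (c * of_nat (lk m i) * lk P m))"

lemma lookup_mderiv: "lk (mderiv c i P) m = c * of_nat (lk m i + 1) * lk P (m + sg i 1)"
proof -
  have "lk (mderiv c i P) m =
      (\<Sum>k\<in>Poly_Mapping.keys P. (c * of_nat (lk k i) * lk P k when k - sg i 1 = m))"
    by (simp add: mderiv_def lookup_sum lookup_single)
  also have "\<dots> = (\<Sum>k\<in>Poly_Mapping.keys P. (if k = m + sg i 1 then c * of_nat (lk k i) * lk P k else 0))"
  proof (rule sum.cong[OF refl])
    fix k
    \<comment> \<open>Subtracting \<open>sg i 1\<close> is invertible only where the exponent of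
      \<open>i\<close> is nonzero; the remaining summands have coefficient zero on both
      sides.\<close>
    have "k - sg i 1 = m \<longleftrightarrow> k = m + sg i 1" if "lk k i \<noteq> 0"
    proof
      assume "k - sg i 1 = m"
      then show "k = m + sg i 1"
        using that by (intro poly_mapping_eqI) (auto simp: lookup_add lookup_minus lookup_single when_def)
    qed simp
    then show "(c * of_nat (lk k i) * lk P k when k - sg i 1 = m) =
        (if k = m + sg i 1 then c * of_nat (lk k i) * lk P k else 0)"
      by (cases "lk k i = 0") (simp_all only: when_def of_nat_0 mult_zero_right mult_zero_left if_cancel, simp)
  qed
  also have "\<dots> = c * of_nat (lk m i + 1) * lk P (m + sg i 1)"
    by (simp add: lookup_add in_keys_iff)
  finally show ?thesis .
qed

text \<open>Freezing all variables but the \<open>i\<close>-th turns \<open>P\<close> into a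
  univariate polynomial, to which root factorisation and \<open>pderiv\<close> apply.\<close>

definition slice :: "nat \<Rightarrow> (nat \<Rightarrow> complex) \<Rightarrow> cpoly \<Rightarrow> complex poly" where
  "slice i x P = (\<Sum>m\<in>Poly_Mapping.keys P.
     monom (lk P m * (\<Prod>j\<in>Poly_Mapping.keys m - {i}. x j ^ lk m j)) (lk m i))"

lemma poly_slice: "poly (slice i x P) t = eval_cpoly P (x(i := t))"
  by (simp add: slice_def poly_sum poly_monom eval_cpoly_def eval_monomial_remove mult.assoc)

lemma pderiv_sum: "pderiv (\<Sum>a\<in>A. F a) = (\<Sum>a\<in>A. pderiv (F a))"
  by (induction A rule: infinite_finite_induct) (auto simp: pderiv_add)

lemma poly_pderiv_slice: "c * poly (pderiv (slice i x P)) t = eval_cpoly (mderiv c i P) (x(i := t))"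
  unfolding slice_def mderiv_def eval_cpoly_sum_single eval_monomial_minus_single_upd
  by (simp add: pderiv_sum pderiv_monom poly_sum poly_monom sum_distrib_left mult_ac)

section \<open>Continuity and the identity theorem on the positive orthant\<close>

lemma continuous_eval_cpoly:
  assumes "\<And>i. continuous (at t within S) (\<lambda>s. x s i)"
  shows "continuous (at t within S) (\<lambda>s. eval_cpoly P (x s))"
  unfolding eval_cpoly_def eval_monomial_def
  by (intro continuous_intros assms)

lemma eval_cpoly_at_0: "eval_cpoly P (\<lambda>_. 0) = lk P 0"
proof -
  have "eval_monomial m (\<lambda>_. 0) = 0" if "m \<noteq> 0" for m
  proof -
    obtain i where "i \<in> Poly_Mapping.keys m" using \<open>m \<noteq> 0\<close> by (metis equals0I keys_eq_empty)
    then show ?thesis by (auto simp: eval_monomial_def in_keys_iff)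
  qed
  then have "lk P m * eval_monomial m (\<lambda>_. 0) = (if m = 0 then lk P m else 0)" for m
    by (cases "m = 0") (auto simp: eval_monomial_def)
  then show ?thesis by (simp add: eval_cpoly_def in_keys_iff)
qed

lemma eval_cpoly_tendsto_constant_coeff:
  "((\<lambda>t. eval_cpoly P (\<lambda>_. complex_of_real t)) \<longlongrightarrow> lk P 0) (at_right 0)"
proof -
  have "continuous (at_right 0) (\<lambda>t::real. eval_cpoly P (\<lambda>_. complex_of_real t))"
    by (intro continuous_eval_cpoly continuous_intros)
  then show ?thesis by (simp add: continuous_within eval_cpoly_at_0)
qed

text \<open>The constant coefficient is the limit of the values at the origin, approached through
  the orthant. For the other coefficients, every slice through a positive point has infinitely many
  roots and is therefore zero, so the partial derivatives also vanish on the orthant and the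
  induction hypothesis applies to them.\<close>

lemma cpoly_eq_0_if_vanishes_on_positive:
  assumes "\<And>a. (\<forall>i. a i > 0) \<Longrightarrow> eval_cpoly P (\<lambda>i. complex_of_real (a i)) = 0"
  shows "P = 0"
proof -
  have "lk P m = 0" for m using assms
  proof (induction m arbitrary: P rule: monomial_induct)
    case zero
    have "\<forall>\<^sub>F t in at_right 0. eval_cpoly P (\<lambda>_. complex_of_real t) = 0"
      using zero by (auto intro: eventually_at_rightI[of 0 1])
    then have "((\<lambda>t. eval_cpoly P (\<lambda>_. complex_of_real t)) \<longlongrightarrow> 0) (at_right 0)"
      by (simp add: tendsto_eventually)
    from tendsto_unique[OF _ eval_cpoly_tendsto_constant_coeff this] show ?case by simp
  next
    case (plus_single m i)
    have "eval_cpoly (mderiv 1 i P) (\<lambda>j. complex_of_real (a j)) = 0" if a: "\<forall>j. a j > 0" for a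
    proof -
      let ?p = "slice i (\<lambda>j. complex_of_real (a j)) P"
      have "poly ?p (complex_of_real t) = 0" if "t > 0" for t
      proof -
        have *: "(\<lambda>j. complex_of_real (a j))(i := complex_of_real t) =
            (\<lambda>j. complex_of_real ((a(i := t)) j))" by auto
        show ?thesis unfolding poly_slice * using a that by (intro plus_single.prems) auto
      qed
      then have "complex_of_real ` {0<..} \<subseteq> {z. poly ?p z = 0}" by auto
      moreover have "infinite (complex_of_real ` {0<..})"
        by (subst finite_image_iff) (auto simp: inj_on_def infinite_Ioi)
      ultimately have "?p = 0" using poly_roots_finite finite_subset by blast
      then show ?thesis
        using poly_pderiv_slice[of 1 i "\<lambda>j. complex_of_real (a j)" P "complex_of_real (a i)"]
        by (simp add: fun_upd_idem)
    qed
    then have "lk (mderiv 1 i P) m = 0" by (rule plus_single.IH) auto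
    then have "of_nat (lk m i + 1) * lk P (m + sg i 1) = 0"
      by (simp only: lookup_mderiv mult_1)
    then show ?case by (simp only: mult_eq_0_iff of_nat_eq_0_iff) simp
  qed
  then show ?thesis by (intro poly_mapping_eqI) simp
qed

text \<open>With a free set \<open>A\<close> and free coefficients \<open>f\<close>, the identity
  theorem applies directly to the top-degree part of a polynomial and to the imaginary parts of its
  coefficients.\<close>

lemma coeffs_eq_0_if_vanishes_on_positive:
  assumes "finite A" "m \<in> A"
    and "\<And>a. (\<forall>i. a i > 0) \<Longrightarrow> (\<Sum>m\<in>A. f m * eval_monomial m (\<lambda>i. complex_of_real (a i))) = 0"
  shows "f m = 0"
proof -
  let ?P = "\<Sum>m\<in>A. sg m (f m)"
  have "?P = 0"
    by (rule cpoly_eq_0_if_vanishes_on_positive) (simp add: eval_cpoly_sum_single assms)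
  moreover have "lk ?P m = f m"
    using assms(1,2) by (simp add: lookup_sum lookup_single when_def)
  ultimately show ?thesis by simp
qed

section \<open>Univariate polynomials with restricted roots\<close>

lemma poly_root_factor_induct [case_names const factor]:
  fixes p :: "complex poly"
  assumes "\<And>c. Q [:c:]"
    and "\<And>r q. q \<noteq> 0 \<Longrightarrow> Q q \<Longrightarrow> Q ([:-r, 1:] * q)"
  shows "Q p"
proof (induction "degree p" arbitrary: p)
  case 0
  then show ?case using assms(1) by (metis degree_eq_zeroE)
next
  case (Suc n)
  then have "\<not> constant (poly p)" by (simp add: constant_degree)
  then obtain r where "poly p r = 0" using fundamental_theorem_of_algebra by blast
  then obtain q where q: "p = [:-r, 1:] * q" by (auto simp: poly_eq_0_iff_dvd)
  have "q \<noteq> 0" using q Suc.hyps(2) by auto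
  then have "degree p = Suc (degree q)" unfolding q by (subst degree_mult_eq) auto
  then show ?case using assms(2) \<open>q \<noteq> 0\<close> Suc q by auto
qed

text \<open>The logarithmic derivative is the sum of \<open>1 / (z - r)\<close> over the roots
  \<open>r\<close>; since \<open>Re r \<le> 0 < Re z\<close>, each term has nonnegative real
  part.\<close>

lemma Re_log_deriv_nonneg:
  assumes "\<And>z. Re z > 0 \<Longrightarrow> poly p z \<noteq> 0" and "Re z > 0"
  shows "Re (poly (pderiv p) z / poly p z) \<ge> 0"
  using assms
proof (induction p rule: poly_root_factor_induct)
  case (const c)
  then show ?case by (simp add: pderiv_pCons)
next
  case (factor r q)
  have r: "Re r \<le> 0" using factor.prems(1)[of r] by (cases "Re r > 0") auto
  have q: "poly q z \<noteq> 0" if "Re z > 0" for z using factor.prems(1)[OF that] by auto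
  have nz: "z - r \<noteq> 0" using r \<open>Re z > 0\<close> by auto
  have "poly (pderiv ([:-r, 1:] * q)) z / poly ([:-r, 1:] * q) z =
      inverse (z - r) + poly (pderiv q) z / poly q z"
    using nz q[OF \<open>Re z > 0\<close>]
    by (simp add: pderiv_mult pderiv_pCons divide_simps del: mult_pCons_left)
  moreover have "Re (inverse (z - r)) \<ge> 0" using r \<open>Re z > 0\<close> by simp
  ultimately show ?case using factor.IH[OF q \<open>Re z > 0\<close>] by simp
qed

text \<open>The value at 0 is the leading coefficient times the product of all \<open>- r\<close>,
  and \<open>- r / \<i>\<close> is real for an imaginary root \<open>r\<close>.\<close>

lemma poly_imaginary_roots_at_0:
  assumes "\<And>z. poly p z = 0 \<Longrightarrow> Re z = 0"
  shows "poly p 0 / (lead_coeff p * \<i> ^ degree p) \<in> \<real>"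
  using assms
proof (induction p rule: poly_root_factor_induct)
  case (const c)
  then show ?case by simp
next
  case (factor r q)
  have r: "r = \<i> * of_real (Im r)" using factor.prems[of r] by (simp add: complex_eq_iff)
  have "degree ([:-r, 1:] * q) = Suc (degree q)"
    using factor.hyps by (subst degree_mult_eq) auto
  moreover have "lead_coeff ([:-r, 1:] * q) = lead_coeff q" by (subst lead_coeff_mult) simp
  ultimately have "poly ([:-r, 1:] * q) 0 /
      (lead_coeff ([:-r, 1:] * q) * \<i> ^ degree ([:-r, 1:] * q)) =
      (- r / \<i>) * (poly q 0 / (lead_coeff q * \<i> ^ degree q))"
    by (simp only: poly_mult power_Suc) (simp add: divide_simps)
  moreover have "- r / \<i> = of_real (- Im r)" by (subst r) simp
  moreover have "poly q 0 / (lead_coeff q * \<i> ^ degree q) \<in> \<real>"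
    using factor by auto
  ultimately show ?case by (metis Reals_mult Reals_of_real)
qed

section \<open>Nonvanishing polynomials and nonnegative coefficients\<close>

text \<open>The half-plane property of a nonzero polynomial, with the number of variables eliminated
  by constraining all indices.\<close>

definition nonvanishing :: "cpoly \<Rightarrow> bool" where
  "nonvanishing P \<longleftrightarrow> (\<forall>x. (\<forall>i. Re (x i) > 0) \<longrightarrow> eval_cpoly P x \<noteq> 0)"

lemma nonvanishingD: "nonvanishing P \<Longrightarrow> (\<And>i. Re (x i) > 0) \<Longrightarrow> eval_cpoly P x \<noteq> 0"
  by (simp add: nonvanishing_def)

text \<open>The quotient is 1 plus \<open>e\<close> times a logarithmic derivative of the slice. Its
  positive real part serves twice: it keeps the new polynomial from vanishing, and it preserves the
  sign at positive real points.\<close>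

lemma nonvanishing_mderiv:
  assumes "nonvanishing P" "e > 0" "\<forall>i. Re (x i) > 0"
  shows "Re (eval_cpoly (P + mderiv (of_real e) i P) x / eval_cpoly P x) > 0"
proof -
  let ?p = "slice i x P"
  have ev: "poly ?p (x i) = eval_cpoly P x" by (simp add: poly_slice)
  have "poly ?p z \<noteq> 0" if "Re z > 0" for z
    using assms that by (auto simp: poly_slice nonvanishing_def)
  then have "Re (poly (pderiv ?p) (x i) / poly ?p (x i)) \<ge> 0"
    by (rule Re_log_deriv_nonneg) (use assms in auto)
  then have *: "0 \<le> e * Re (poly (pderiv ?p) (x i) / eval_cpoly P x)"
    using assms(2) by (simp add: ev)
  have "eval_cpoly (mderiv (of_real e) i P) x = of_real e * poly (pderiv ?p) (x i)"
    by (simp add: poly_pderiv_slice)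
  then have "eval_cpoly (P + mderiv (of_real e) i P) x / eval_cpoly P x =
      1 + of_real e * (poly (pderiv ?p) (x i) / eval_cpoly P x)"
    using assms by (simp add: eval_cpoly_add nonvanishing_def field_simps)
  moreover have "Re (of_real e * (poly (pderiv ?p) (x i) / eval_cpoly P x)) =
      e * Re (poly (pderiv ?p) (x i) / eval_cpoly P x)"
    by (simp only: times_complex.sel Re_complex_of_real Im_complex_of_real)
  ultimately show ?thesis using * by (simp only: plus_complex.sel one_complex.sel)
qed

lemma eval_cpoly_real:
  assumes "\<forall>m. lk P m \<in> \<real>"
  shows "eval_cpoly P (\<lambda>i. complex_of_real (a i)) \<in> \<real>"
  unfolding eval_cpoly_def eval_monomial_def
  by (intro sum_in_Reals Reals_mult prod_in_Reals Reals_power Reals_of_real) (use assms in auto)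

text \<open>The constant coefficient is a limit of positive values. Otherwise the hypotheses pass to
  \<open>P + mderiv e i P\<close>, whose coefficient at \<open>m\<close> is affine in
  \<open>e\<close> with slope a positive multiple of the coefficient at \<open>m + sg i 1\<close>;
  nonnegativity for all \<open>e > 0\<close> forces a nonnegative slope.\<close>

lemma coeff_nonneg:
  assumes "nonvanishing P" "\<forall>m. lk P m \<in> \<real>"
    and "\<And>a. (\<forall>i. a i > 0) \<Longrightarrow> Re (eval_cpoly P (\<lambda>i. complex_of_real (a i))) > 0"
  shows "Re (lk P m) \<ge> 0"
  using assms
proof (induction m arbitrary: P rule: monomial_induct)
  case zero
  have "((\<lambda>t. Re (eval_cpoly P (\<lambda>_. complex_of_real t))) \<longlongrightarrow> Re (lk P 0)) (at_right 0)"
    by (intro tendsto_Re eval_cpoly_tendsto_constant_coeff)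
  moreover have "\<forall>\<^sub>F t in at_right 0. 0 \<le> Re (eval_cpoly P (\<lambda>_. complex_of_real t))"
    using zero(3) by (auto intro!: eventually_at_rightI[of 0 1] less_imp_le)
  ultimately show ?case by (rule tendsto_lowerbound) simp
next
  case (plus_single m i)
  let ?a = "Re (lk P m)" and ?b = "real (lk m i + 1) * Re (lk P (m + sg i 1))"
  have key: "0 \<le> ?a + e * ?b" if "e > 0" for e
  proof -
    let ?Q = "P + mderiv (of_real e) i P"
    have lookup: "lk ?Q k = lk P k + of_real (e * real (lk k i + 1)) * lk P (k + sg i 1)" for k
      by (simp add: lookup_add lookup_mderiv)
    have "Re (lk ?Q m) \<ge> 0"
    proof (rule plus_single.IH)
      \<comment> \<open>A zero of \<open>?Q\<close> would make the quotient by \<open>P\<close>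
        zero, contradicting its positive real part.\<close>
      show "nonvanishing ?Q"
        using nonvanishing_mderiv[OF plus_single.prems(1) that, of _ i]
        unfolding nonvanishing_def by (metis div_0 less_irrefl zero_complex.sel(1))
      show "\<forall>k. lk ?Q k \<in> \<real>"
        unfolding lookup using plus_single.prems(2) by (intro allI Reals_add Reals_mult Reals_of_real) auto
      fix a :: "nat \<Rightarrow> real" assume a: "\<forall>i. a i > 0"
      let ?x = "\<lambda>i. complex_of_real (a i)"
      obtain r where r: "eval_cpoly P ?x = of_real r"
        using eval_cpoly_real[OF plus_single.prems(2)] by (auto elim: Reals_cases)
      have "r > 0" using plus_single.prems(3)[OF a] r by simp
      moreover have "Re (eval_cpoly ?Q ?x / eval_cpoly P ?x) > 0"
        using a by (intro nonvanishing_mderiv plus_single.prems that) auto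
      ultimately show "Re (eval_cpoly ?Q ?x) > 0"
        by (simp add: r zero_less_divide_iff)
    qed
    then show ?thesis unfolding lookup by (simp add: mult.assoc)
  qed
  have "?b \<ge> 0"
  proof (rule ccontr)
    assume "\<not> ?b \<ge> 0"
    then have b: "?b < 0" by simp
    \<comment> \<open>The choice \<open>e = (\<bar>?a\<bar> + 1) / B\<close> makes the affine
      expression equal to \<open>?a - \<bar>?a\<bar> - 1\<close>, which is negative.\<close>
    obtain B where B: "?b = - B" "B > 0" using b by (metis minus_minus neg_0_less_iff_less)
    then have "(\<bar>?a\<bar> + 1) / B * ?b = - (\<bar>?a\<bar> + 1)" by simp
    moreover have "(\<bar>?a\<bar> + 1) / B > 0" using B by simp
    ultimately show False using key[of "(\<bar>?a\<bar> + 1) / B"]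
      by (simp only:) (simp add: abs_if split: if_splits)
  qed
  then show ?case by (simp add: zero_le_mult_iff)
qed

section \<open>Restriction to lines, and reality of the coefficients up to a constant\<close>

definition line :: "(nat \<Rightarrow> complex) \<Rightarrow> (nat \<Rightarrow> complex) \<Rightarrow> monomial \<Rightarrow> complex poly" where
  "line b a m = (\<Prod>i\<in>Poly_Mapping.keys m. [:b i, a i:] ^ lk m i)"

lemma poly_line: "poly (line b a m) t = eval_monomial m (\<lambda>i. a i * t + b i)"
  by (simp add: line_def poly_prod poly_power eval_monomial_def algebra_simps)

lemma degree_line:
  assumes "\<And>i. a i \<noteq> 0"
  shows "degree (line b a m) = total_degree m"
  using assms by (simp add: line_def total_degree_def degree_prod_eq_sum_degree degree_power_eq)

text \<open>Only the direction \<open>a\<close> enters, not the base point \<open>b\<close>; this is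
  what makes one constant work for all imaginary shifts.\<close>

lemma lead_coeff_line:
  assumes "\<And>i. a i \<noteq> 0"
  shows "lead_coeff (line b a m) = eval_monomial m a"
  using assms by (simp add: line_def lead_coeff_prod lead_coeff_power eval_monomial_def)

lemma eval_cpoly_minus:
  assumes "definite_parity P" "m0 \<in> Poly_Mapping.keys P"
  shows "eval_cpoly P (\<lambda>i. - 1 * x i) = (-1) ^ total_degree m0 * eval_cpoly P x"
proof -
  have "lk P m * eval_monomial m (\<lambda>i. - 1 * x i) =
      (-1) ^ total_degree m0 * (lk P m * eval_monomial m x)" if "m \<in> Poly_Mapping.keys P" for m
  proof -
    have "even (total_degree m) \<longleftrightarrow> even (total_degree m0)"
      using assms that unfolding definite_parity_def by blast
    then have "(-1 :: complex) ^ total_degree m = (-1) ^ total_degree m0"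
      by (simp add: minus_one_power_iff)
    then show ?thesis by (simp only: eval_monomial_scale mult.left_commute)
  qed
  then show ?thesis
    unfolding eval_cpoly_def sum_distrib_left by (intro sum.cong refl)
qed

text \<open>Lines in a fixed positive direction show that the values at imaginary points are real up
  to one constant; the identity theorem transfers this to the coefficients, and parity absorbs the
  powers of \<open>\<i>\<close>. The second conjunct rules out the degenerate division by
  \<open>K = 0\<close>.\<close>

lemma coeffs_real_multiple:
  assumes par: "definite_parity P" and nv: "nonvanishing P"
  shows "\<exists>K. \<forall>m. lk P m / K \<in> \<real> \<and> (lk P m \<noteq> 0 \<longrightarrow> K \<noteq> 0)"
proof (cases "P = 0")
  case True
  then show ?thesis by auto
next
  case False
  define N where "N = Max (total_degree ` Poly_Mapping.keys P)"
  define T where "T = {m \<in> Poly_Mapping.keys P. total_degree m = N}"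
  have ne: "Poly_Mapping.keys P \<noteq> {}" using False by simp
  have le: "total_degree m \<le> N" if "m \<in> Poly_Mapping.keys P" for m
    using that by (simp add: N_def)
  have "N \<in> total_degree ` Poly_Mapping.keys P" unfolding N_def using ne by (intro Max_in) auto
  then obtain m0 where m0: "m0 \<in> T" by (auto simp: T_def)
  \<comment> \<open>A direction on which the top-degree part is nonzero, so that the restriction to
    each line in this direction has degree exactly \<open>N\<close>.\<close>
  have "\<exists>a. (\<forall>i. a i > 0) \<and> (\<Sum>m\<in>T. lk P m * eval_monomial m (\<lambda>i. complex_of_real (a i))) \<noteq> 0"
  proof (rule ccontr)
    assume *: "\<not> ?thesis"
    have "lk P m0 = 0"
      by (rule coeffs_eq_0_if_vanishes_on_positive[where f = "lk P" and A = T])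
        (use * m0 in \<open>auto simp: T_def\<close>)
    then show False using m0 by (simp add: T_def in_keys_iff)
  qed
  then obtain a where a: "\<forall>i. a i > 0"
    and L: "(\<Sum>m\<in>T. lk P m * eval_monomial m (\<lambda>i. complex_of_real (a i))) \<noteq> 0" (is "?L \<noteq> 0") by blast
  \<comment> \<open>The normalising factor for polynomials with imaginary roots: leading coefficient
    times \<open>\<i>\<close> to the degree.\<close>
  define K where "K = ?L * \<i> ^ N"
  have neg: "eval_cpoly P (\<lambda>i. - 1 * x i) = (-1) ^ total_degree m0 * eval_cpoly P x" for x
    using m0 by (intro eval_cpoly_minus[OF par]) (simp add: T_def)
  have real: "eval_cpoly P (\<lambda>i. \<i> * of_real (b i)) / K \<in> \<real>" for b :: "nat \<Rightarrow> real"
  proof -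
    let ?a = "\<lambda>i. complex_of_real (a i)" and ?b = "\<lambda>i. \<i> * complex_of_real (b i)"
    define q where "q = (\<Sum>m\<in>Poly_Mapping.keys P. smult (lk P m) (line ?b ?a m))"
    have a0: "?a i \<noteq> 0" for i using a by (metis less_irrefl of_real_eq_0_iff)
    have q: "poly q t = eval_cpoly P (\<lambda>i. ?a i * t + ?b i)" for t
      by (simp add: q_def poly_sum poly_line eval_cpoly_def)
    have "coeff q N = (\<Sum>m\<in>Poly_Mapping.keys P. lk P m * coeff (line ?b ?a m) N)"
      by (simp add: q_def coeff_sum)
    also have "\<dots> = ?L"
    proof (rule sum.mono_neutral_cong_right)
      show "\<forall>m\<in>Poly_Mapping.keys P - T. lk P m * coeff (line ?b ?a m) N = 0"
      proof
        fix m assume m: "m \<in> Poly_Mapping.keys P - T"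
        then have "total_degree m < N" using le[of m] by (auto simp: T_def)
        then show "lk P m * coeff (line ?b ?a m) N = 0"
          using degree_line[of ?a ?b m, OF a0] by (simp add: coeff_eq_0)
      qed
      fix m assume "m \<in> T"
      then show "lk P m * coeff (line ?b ?a m) N = lk P m * eval_monomial m ?a"
        using degree_line[of ?a ?b m, OF a0] lead_coeff_line[of ?a ?b m, OF a0] by (simp add: T_def)
    qed (auto simp: T_def)
    finally have cN: "coeff q N = ?L" .
    have "degree q \<le> N" unfolding q_def
      by (intro degree_sum_le) (auto intro!: order.trans[OF degree_smult_le] simp: degree_line[OF a0] le)
    then have deg: "degree q = N" using cN L by (metis le_antisym le_degree)
    \<comment> \<open>The points of the line have real parts \<open>a i * Re z\<close>. For negative
      \<open>Re z\<close>, negating the point moves it into the right half-space, and by parity this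
      changes \<open>P\<close> only by a sign.\<close>
    have "Re z = 0" if "poly q z = 0" for z
    proof (rule ccontr)
      assume "Re z \<noteq> 0"
      then consider "Re z > 0" | "Re z < 0" by linarith
      then show False
      proof cases
        case 1
        then have "\<forall>i. Re (?a i * z + ?b i) > 0" using a by simp
        then show False using nv that by (auto simp: q nonvanishing_def)
      next
        case 2
        then have "\<forall>i. Re (- 1 * (?a i * z + ?b i)) > 0" using a by (simp add: mult_pos_neg)
        then have "eval_cpoly P (\<lambda>i. - 1 * (?a i * z + ?b i)) \<noteq> 0"
          by (intro nonvanishingD[OF nv]) blast
        then show False using that by (simp only: neg q mult_zero_right simp_thms)
      qed
    qed
    then have "poly q 0 / (lead_coeff q * \<i> ^ degree q) \<in> \<real>"
      by (rule poly_imaginary_roots_at_0)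
    then show ?thesis by (simp add: deg cN q K_def)
  qed
  \<comment> \<open>As a polynomial in \<open>b\<close>, the value of \<open>P\<close> at
    \<open>\<i> * b\<close> has coefficients \<open>lk P m * \<i> ^ total_degree m\<close>.\<close>
  have coeff_real: "lk P m * \<i> ^ total_degree m / K \<in> \<real>" if m: "m \<in> Poly_Mapping.keys P" for m
  proof -
    let ?d = "\<lambda>m. lk P m * \<i> ^ total_degree m / K"
    have "complex_of_real (Im (?d m)) = 0"
    proof (rule coeffs_eq_0_if_vanishes_on_positive[where
          f = "\<lambda>m. complex_of_real (Im (?d m))", OF finite_keys m])
      fix b :: "nat \<Rightarrow> real"
      let ?r = "\<lambda>m. \<Prod>i\<in>Poly_Mapping.keys m. b i ^ lk m i"
      have ev: "eval_monomial m (\<lambda>i. complex_of_real (b i)) = of_real (?r m)" for m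
        by (simp add: eval_monomial_def)
      have "eval_cpoly P (\<lambda>i. \<i> * of_real (b i)) / K = (\<Sum>m\<in>Poly_Mapping.keys P. ?d m * of_real (?r m))"
        unfolding eval_cpoly_def eval_monomial_scale ev
        by (simp add: sum_divide_distrib mult.assoc)
      then have "Im (\<Sum>m\<in>Poly_Mapping.keys P. ?d m * of_real (?r m)) = 0"
        using real[of b] by (simp add: complex_is_Real_iff)
      then have "(\<Sum>m\<in>Poly_Mapping.keys P. Im (?d m) * ?r m) = 0"
        by (simp only: Im_sum times_complex.sel Re_complex_of_real Im_complex_of_real
            mult_zero_right add_0)
      then show "(\<Sum>m\<in>Poly_Mapping.keys P. complex_of_real (Im (?d m)) *
          eval_monomial m (\<lambda>i. complex_of_real (b i))) = 0"
        unfolding ev of_real_mult[symmetric] of_real_sum[symmetric] by simp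
    qed
    then show ?thesis by (simp add: complex_is_Real_iff)
  qed
  show ?thesis
  \<comment> \<open>The witness is \<open>?L\<close>: the degrees differ from \<open>N\<close> by
    even numbers, so passing from \<open>K\<close> to \<open>?L\<close> costs only a sign in each
    coefficient.\<close>
  proof (intro exI allI conjI impI)
    fix m
    show "?L \<noteq> 0" by (rule L)
    show "lk P m / ?L \<in> \<real>"
    proof (cases "m \<in> Poly_Mapping.keys P")
      case True
      have "even (total_degree m) \<longleftrightarrow> even N"
        using par m0 True unfolding definite_parity_def T_def by blast
      then have "even (N - total_degree m)" by simp
      then obtain k where "N - total_degree m = 2 * k" by (rule evenE)
      then have k: "N = total_degree m + 2 * k" using le[OF True] by simp
      have "lk P m / ?L = (lk P m * \<i> ^ total_degree m / K) * (-1) ^ k"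
        using L by (simp add: K_def k power_add power_mult)
      also have "\<dots> \<in> \<real>"
        by (intro Reals_mult coeff_real True Reals_power) simp
      finally show ?thesis .
    qed (simp add: in_keys_iff)
  qed
qed

section \<open>Positivity on the orthant and the final normalisation\<close>

text \<open>Along the segment from the all-ones point to \<open>a\<close>, which stays in the
  positive orthant, the values are real and nonzero and start at 1. The intermediate value theorem
  forbids a change of sign.\<close>

lemma nonvanishing_real_pos:
  assumes "nonvanishing P" "\<forall>m. lk P m \<in> \<real>" "eval_cpoly P (\<lambda>_. 1) = 1" "\<forall>i. a i > 0"
  shows "Re (eval_cpoly P (\<lambda>i. complex_of_real (a i))) > 0"
proof (rule ccontr)
  let ?f = "\<lambda>s. Re (eval_cpoly P (\<lambda>i. complex_of_real ((1 - s) + s * a i)))"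
  assume "\<not> ?thesis"
  then have "?f 1 \<le> 0" by simp
  moreover have "0 \<le> ?f 0" using assms(3) by simp
  moreover have "continuous_on {0..1} ?f"
    unfolding continuous_on_eq_continuous_within
    by (intro ballI continuous_Re continuous_eval_cpoly continuous_intros)
  ultimately obtain s where s: "0 \<le> s" "s \<le> 1" "?f s = 0"
    using IVT2'[of ?f 1 0 0] by auto
  have "(1 - s) + s * a i > 0" for i
    using s(1,2) assms(4) by (cases "s = 0") (auto intro: add_nonneg_pos)
  then have "eval_cpoly P (\<lambda>i. complex_of_real ((1 - s) + s * a i)) \<noteq> 0"
    by (intro nonvanishingD[OF assms(1)]) simp
  moreover have "eval_cpoly P (\<lambda>i. complex_of_real ((1 - s) + s * a i)) \<in> \<real>"
    by (rule eval_cpoly_real[OF assms(2)])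
  ultimately show False using s(3) by (auto elim!: Reals_cases)
qed

theorem theorem6p2:
  fixes n :: nat and P :: cpoly
  assumes "in_variables n P"
    and "definite_parity P"
    and "half_plane_property n P"
  shows "\<forall>m m'. Poly_Mapping.lookup P m \<noteq> 0 \<longrightarrow> Poly_Mapping.lookup P m' \<noteq> 0 \<longrightarrow>
           Poly_Mapping.lookup P m / Poly_Mapping.lookup P m' \<in> complex_of_real ` {0<..}"
proof (cases "P = 0")
  case True
  then show ?thesis by simp
next
  case False
  then have nv: "nonvanishing P" using assms(3) by (auto simp: half_plane_property_def nonvanishing_def)
  obtain K where K: "\<And>m. lk P m / K \<in> \<real>" and K0: "\<And>m. lk P m \<noteq> 0 \<Longrightarrow> K \<noteq> 0"
    using coeffs_real_multiple[OF assms(2) nv] by blast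
  have "K \<noteq> 0" using False K0 by (metis poly_mapping_eqI lookup_zero)
  \<comment> \<open>Dividing by the value at the all-ones point instead of \<open>K\<close> also
    fixes the sign; the coefficients stay real because \<open>c / K\<close> is real.\<close>
  define c where "c = eval_cpoly P (\<lambda>_. 1)"
  have c0: "c \<noteq> 0" using nv by (simp add: c_def nonvanishing_def)
  have "c / K = (\<Sum>m\<in>Poly_Mapping.keys P. lk P m / K)"
    by (simp add: c_def eval_cpoly_def eval_monomial_def sum_divide_distrib)
  then have "c / K \<in> \<real>" using K by (metis sum_in_Reals)
  then have "(lk P m / K) / (c / K) \<in> \<real>" for m by (intro Reals_divide[OF K])
  then have real: "lk P m / c \<in> \<real>" for m using \<open>K \<noteq> 0\<close> by simp
  define Q where "Q = (\<Sum>m\<in>Poly_Mapping.keys P. sg m (lk P m / c))"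
  have lkQ: "lk Q m = lk P m / c" for m
    by (simp add: Q_def lookup_sum lookup_single when_def in_keys_iff)
  have evQ: "eval_cpoly Q x = eval_cpoly P x / c" for x
    by (simp add: Q_def eval_cpoly_sum_single) (simp add: eval_cpoly_def sum_divide_distrib)
  have nvQ: "nonvanishing Q" using nv c0 by (simp add: nonvanishing_def evQ)
  have realQ: "\<forall>m. lk Q m \<in> \<real>" by (simp add: lkQ real)
  have "eval_cpoly Q (\<lambda>_. 1) = 1" using c0 by (simp add: evQ c_def)
  then have nonneg: "Re (lk Q m) \<ge> 0" for m
    using nonvanishing_real_pos[OF nvQ realQ] by (intro coeff_nonneg nvQ realQ)
  have pos: "\<exists>r>0. lk P m = c * of_real r" if "lk P m \<noteq> 0" for m
  proof (intro exI conjI)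
    have eq: "lk Q m = of_real (Re (lk Q m))" using realQ by simp
    then show "lk P m = c * of_real (Re (lk Q m))" using c0 by (simp add: lkQ)
    have "lk Q m \<noteq> 0" using that c0 by (simp add: lkQ)
    then show "Re (lk Q m) > 0" using eq nonneg[of m] by (metis less_eq_real_def of_real_0)
  qed
  show ?thesis
  proof (intro allI impI)
    fix m m' assume "lk P m \<noteq> 0" "lk P m' \<noteq> 0"
    then obtain r s where rs: "r > 0" "s > 0" "lk P m = c * of_real r" "lk P m' = c * of_real s"
      using pos by meson
    then have "lk P m / lk P m' = of_real (r / s)" using c0 by simp
    moreover have "r / s \<in> {0<..}" using rs by simp
    ultimately show "lk P m / lk P m' \<in> complex_of_real ` {0<..}" by (rule image_eqI)
  qed
qed

end
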